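(* Let $A, B$ be positive integers such that $A$ is square-free, $A>1$, $AB$ is odd, and $AB$ is not a perfect square. Then the equation $$Ax^2-By^4=4$$ has at most one solution in positive and relatively prime integers $x$ and $y$. *)

theory Defs
  imports
    "HOL-Computational_Algebra.Squarefree"
    "HOL-Computational_Algebra.Nth_Powers"
begin

end

theory Submission
  imports Defs "HOL-Number_Theory.Number_Theory"
begin

text \<open>
  Let \<open>\<alpha> = (a \<surd>A + b \<surd>C) / 2\<close> come from the least positive solution of
  \<open>A x\<^sup>2 - C z\<^sup>2 = 4\<close>. All positive solutions come from the odd powers of \<open>\<alpha>\<close>, so that
  \<open>z = b W\<^sub>n\<close>, where \<open>W\<^sub>0 = 1\<close>, \<open>W\<^sub>1 = v + 1\<close>, \<open>W\<^sub>n\<^sub>+\<^sub>2 = v W\<^sub>n\<^sub>+\<^sub>1 - W\<^sub>n\<close> and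
  \<open>v = \<alpha>\<^sup>2 + \<alpha>\<^sup>-\<^sup>2 = A a\<^sup>2 - 2\<close>.

  Given two solutions with second components \<open>y\<^sub>1, y\<^sub>2\<close> and \<open>g = gcd y\<^sub>1 y\<^sub>2\<close>, take
  \<open>C = B g\<^sup>4\<close> and \<open>z\<^sub>i = (y\<^sub>i / g)\<^sup>2\<close>. Now \<open>b\<close> divides the coprime numbers \<open>z\<^sub>1, z\<^sub>2\<close>, hence
  \<open>b = 1\<close> and both \<open>z\<^sub>i\<close> are odd squares among the \<open>W\<^sub>n\<close>. It remains to see that \<open>W\<^sub>n\<close> is
  an odd square only for \<open>n = 0\<close>. With \<open>V\<^sub>k = \<alpha>\<^sup>2\<^sup>k + \<alpha>\<^sup>-\<^sup>2\<^sup>k\<close> one has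
  \<open>W\<^sub>n\<^sub>+\<^sub>2\<^sub>k \<equiv> - W\<^sub>n (mod V\<^sub>k)\<close>; if \<open>n \<equiv> c (mod 4)\<close>, \<open>n > c\<close>, this gives
  \<open>W\<^sub>n \<equiv> - W\<^sub>c\<close> modulo some \<open>V\<^sub>k\<close> with \<open>k \<ge> 2\<close> a power of two, and \<open>V\<^sub>k \<equiv> 3 (mod 4)\<close>. For
  \<open>c = 0, 1, 2\<close> the Jacobi symbol \<open>(W\<^sub>c / V\<^sub>k)\<close> is 1, a contradiction. For \<open>c = 2\<close> this uses
  \<open>v \<equiv> 1 (mod 4)\<close>, which holds since \<open>W\<^sub>n \<equiv> -1 (mod v)\<close>. If \<open>n \<equiv> 3 (mod 4)\<close>, then -1 is a square
  modulo both \<open>v\<close> and \<open>v + 2\<close>, which is impossible.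
  Finally \<open>W\<^sub>1 = v + 1\<close> is even and \<open>v\<^sup>2 < W\<^sub>2 < (v + 1)\<^sup>2\<close>.
\<close>

section \<open>The Jacobi symbol\<close>

lemma odd_induct [consumes 2, case_names one factor]:
  fixes n :: int
  assumes "n > 0" and "odd n" and "P 1"
    and step: "\<And>p n. prime p \<Longrightarrow> odd p \<Longrightarrow> n > 0 \<Longrightarrow> odd n \<Longrightarrow> P n \<Longrightarrow> P (p * n)"
  shows "P n"
proof -
  have "n > 0 \<Longrightarrow> odd n \<Longrightarrow> P n"
  proof (induction n rule: prime_divisors_induct)
    case zero
    then show ?case by simp
  next
    case (unit x)
    then show ?case using \<open>P 1\<close> by (auto simp: zdvd1_eq)
  next
    case (factor p x)
    then have "x > 0" using prime_gt_0_int[of p] by (simp add: zero_less_mult_iff)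
    with factor show ?case by (intro step) auto
  qed
  then show ?thesis using assms by blast
qed

text \<open>By Euler's criterion both sides agree modulo \<open>p\<close>. They differ by at most 2,
  which is less than \<open>p\<close>, so they are equal.\<close>

lemma Legendre_mult:
  fixes p :: int
  assumes "prime p" and "odd p"
  shows "Legendre (a * b) p = Legendre a p * Legendre b p"
proof -
  define q where "q = nat p"
  have p: "p = int q" "prime q" using assms by (auto simp: q_def prime_ge_0_int)
  have q2: "2 < q" using p assms prime_ge_2_nat[of q] by (cases "q = 2") auto
  have "[Legendre (a * b) p = (a * b) ^ ((q - 1) div 2)] (mod p)"
    unfolding p by (rule euler_criterion) (use p q2 in auto)
  moreover have "[Legendre a p * Legendre b p = a ^ ((q - 1) div 2) * b ^ ((q - 1) div 2)] (mod p)"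
    unfolding p by (intro cong_mult euler_criterion) (use p q2 in auto)
  ultimately have "[Legendre (a * b) p = Legendre a p * Legendre b p] (mod p)"
    by (simp add: power_mult_distrib) (metis cong_sym cong_trans)
  then have "p dvd Legendre (a * b) p - Legendre a p * Legendre b p"
    by (simp add: cong_iff_dvd_diff)
  moreover have "\<bar>Legendre (a * b) p - Legendre a p * Legendre b p\<bar> < p"
    using q2 p by (auto simp: Legendre_def)
  ultimately show ?thesis
    using zdvd_imp_le[of p "\<bar>Legendre (a * b) p - Legendre a p * Legendre b p\<bar>"] by auto
qed

lemma Legendre_cong:
  assumes "[a = b] (mod p)"
  shows "Legendre a p = Legendre b p"
proof -
  have "[a = 0] (mod p) \<longleftrightarrow> [b = 0] (mod p)" "QuadRes p a \<longleftrightarrow> QuadRes p b"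
    unfolding QuadRes_def using assms by (meson cong_sym cong_trans)+
  then show ?thesis by (simp add: Legendre_def)
qed

text \<open>The multiset counts each prime with its multiplicity, so for positive odd
  \<open>n\<close> this is the classical Jacobi symbol.\<close>

definition jacobi :: "int \<Rightarrow> int \<Rightarrow> int" where
  "jacobi a n = (\<Prod>p\<in>#prime_factorization n. Legendre a p)"

lemma jacobi_1_right [simp]: "jacobi a 1 = 1"
  by (simp add: jacobi_def)

lemma jacobi_prime_mult:
  assumes "prime p" and "n > 0"
  shows "jacobi a (p * n) = Legendre a p * jacobi a n"
  using assms by (simp add: jacobi_def prime_factorization_mult prime_factorization_prime)

lemma jacobi_cong: "[a = b] (mod n) \<Longrightarrow> jacobi a n = jacobi b n"
  unfolding jacobi_def
  by (intro arg_cong[where f = prod_mset] image_mset_cong Legendre_cong)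
     (auto intro: cong_dvd_modulus)

lemma jacobi_mult_left:
  assumes "n > 0" and "odd n"
  shows "jacobi (a * b) n = jacobi a n * jacobi b n"
  using assms
proof (induction n rule: odd_induct)
  case (factor p n)
  then show ?case by (simp add: jacobi_prime_mult Legendre_mult)
qed simp

lemma jacobi_1_left:
  assumes "n > 0" and "odd n"
  shows "jacobi 1 n = 1"
  using assms
proof (induction n rule: odd_induct)
  case (factor p n)
  have "Legendre 1 p = 1" using factor prime_gt_1_int[of p]
    by (auto simp: Legendre_def QuadRes_def cong_iff_dvd_diff intro: exI[of _ 1])
  with factor show ?case by (simp add: jacobi_prime_mult)
qed simp

lemma jacobi_range: "jacobi a n \<in> {-1, 0, 1}"
proof -
  have "prod_mset (image_mset (\<lambda>p. Legendre a p) M) \<in> {-1, 0, 1}" for M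
    by (induction M) (auto simp: Legendre_def)
  then show ?thesis unfolding jacobi_def .
qed

text \<open>An inverse of \<open>a\<close> modulo \<open>n\<close> shows that
  \<open>jacobi a n\<close> is nonzero, hence 1 or -1.\<close>

lemma jacobi_square:
  assumes "n > 0" and "odd n" and "coprime a n"
  shows "jacobi (a^2) n = 1"
proof -
  obtain b where "[a * b = 1] (mod n)"
    using cong_solve_coprime_int[OF \<open>coprime a n\<close>] by blast
  then have "jacobi a n * jacobi b n = 1"
    using jacobi_cong jacobi_1_left jacobi_mult_left assms by metis
  with jacobi_range[of a n] show ?thesis
    using assms by (auto simp: power2_eq_square jacobi_mult_left)
qed

lemma jacobi_square_neq:
  assumes "n > 0" and "odd n"
  shows "jacobi (a^2) n \<noteq> -1"
  using jacobi_range[of a n] assms by (auto simp: power2_eq_square jacobi_mult_left)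

section \<open>Residues modulo 4, the symbol at -1, and reciprocity\<close>

lemma even_half_iff_mod_4:
  fixes n :: int
  assumes "odd n"
  shows "even ((n - 1) div 2) \<longleftrightarrow> [n = 1] (mod 4)"
    and "even ((n - 1) div 2) \<longleftrightarrow> \<not> [n = 3] (mod 4)"
  using assms by (auto elim!: oddE simp: cong_def; presburger)+

lemma cong_3_mult_iff:
  fixes m n :: int
  assumes "odd m" and "odd n"
  shows "[m * n = 3] (mod 4) \<longleftrightarrow> [m = 3] (mod 4) \<noteq> [n = 3] (mod 4)"
proof -
  have "m mod 4 \<in> {1, 3}" and "n mod 4 \<in> {1, 3}"
    using assms by (simp; presburger)+
  then show ?thesis
    unfolding cong_def mod_mult_eq[of m 4 n, symmetric] by auto
qed

lemma cong_1_iff_not_cong_3: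
  fixes n :: int
  assumes "odd n"
  shows "[n = 1] (mod 4) \<longleftrightarrow> \<not> [n = 3] (mod 4)"
  using even_half_iff_mod_4[OF assms] by simp

lemma Legendre_minus_1:
  fixes p :: int
  assumes "prime p" and "odd p"
  shows "Legendre (-1) p = (if [p = 1] (mod 4) then 1 else -1)"
proof -
  define q where "q = nat p"
  have p: "p = int q" "prime q" using assms by (auto simp: q_def prime_ge_0_int)
  have q2: "2 < q" using p assms prime_ge_2_nat[of q] by (cases "q = 2") auto
  have "[Legendre (-1) p = (-1) ^ ((q - 1) div 2)] (mod p)"
    unfolding p by (rule euler_criterion) (use p q2 in auto)
  then have "p dvd Legendre (-1) p - (-1) ^ ((q - 1) div 2)"
    by (simp add: cong_iff_dvd_diff)
  moreover have "\<bar>Legendre (-1) p - (-1) ^ ((q - 1) div 2)\<bar> < p"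
    using q2 p by (cases "even ((q - 1) div 2)") (auto simp: Legendre_def)
  ultimately have *: "Legendre (-1) p = (-1) ^ ((q - 1) div 2)"
    using zdvd_imp_le[of p "\<bar>Legendre (-1) p - (-1) ^ ((q - 1) div 2)\<bar>"] by auto
  have "int ((q - 1) div 2) = (p - 1) div 2" using q2 p by (simp add: zdiv_int of_nat_diff)
  then have "even ((q - 1) div 2) \<longleftrightarrow> [p = 1] (mod 4)"
    using even_half_iff_mod_4(1)[OF assms(2)] by (metis even_of_nat)
  then show ?thesis using * by simp
qed

lemma jacobi_minus_1:
  assumes "n > 0" and "odd n"
  shows "jacobi (-1) n = (if [n = 1] (mod 4) then 1 else -1)"
  using assms
proof (induction n rule: odd_induct)
  case (factor p n)
  then show ?case
    by (simp add: jacobi_prime_mult Legendre_minus_1 cong_1_iff_not_cong_3 cong_3_mult_iff)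
qed simp

lemma Legendre_reciprocity:
  fixes p q :: int
  assumes "prime p" "odd p" "prime q" "odd q"
  shows "Legendre p q = (if [p = 3] (mod 4) \<and> [q = 3] (mod 4) then -1 else 1) * Legendre q p"
\<comment> \<open>For \<open>p = q\<close> both symbols vanish; for distinct primes this is
  quadratic reciprocity.\<close>
proof (cases "p = q")
  case True
  then have "Legendre p q = 0" "Legendre q p = 0" by (simp_all add: Legendre_def cong_def)
  then show ?thesis by simp
next
  case False
  have gt: "2 < p" "2 < q" using assms prime_ge_2_int[of p] prime_ge_2_int[of q]
    by (metis dvd_refl order_le_less)+
  define h where "h = nat ((p - 1) div 2 * ((q - 1) div 2))"
  have *: "Legendre p q * Legendre q p = (-1) ^ h"
    unfolding h_def using assms gt False by (intro Quadratic_Reciprocity_int) simp_all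
  have "int h = (p - 1) div 2 * ((q - 1) div 2)"
    unfolding h_def using gt by (intro nat_0_le mult_nonneg_nonneg) (simp_all add: pos_imp_zdiv_nonneg_iff)
  then have "even (int h) \<longleftrightarrow> even ((p - 1) div 2 * ((q - 1) div 2))"
    by (simp only:)
  also have "\<dots> \<longleftrightarrow> even ((p - 1) div 2) \<or> even ((q - 1) div 2)" by simp
  also have "\<dots> \<longleftrightarrow> \<not> ([p = 3] (mod 4) \<and> [q = 3] (mod 4))"
    unfolding even_half_iff_mod_4(2)[OF assms(2)] even_half_iff_mod_4(2)[OF assms(4)] by simp
  finally have "even h \<longleftrightarrow> \<not> ([p = 3] (mod 4) \<and> [q = 3] (mod 4))"
    by (simp only: even_of_nat)
  then have h: "(-1) ^ h = (if [p = 3] (mod 4) \<and> [q = 3] (mod 4) then -1 else 1 :: int)"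
    by (auto simp: minus_one_power_iff)
  have "Legendre q p \<noteq> 0"
  proof
    assume "Legendre q p = 0"
    with * show False by simp
  qed
  then have "Legendre q p * Legendre q p = 1" by (simp add: Legendre_def split: if_splits)
  then have "Legendre p q = (-1) ^ h * Legendre q p" using * by (metis mult.assoc mult.right_neutral)
  then show ?thesis by (simp only: h)
qed

text \<open>The sign \<open>e\<close> is symmetric and multiplicative in each argument. So the law
  for primes extends first to a composite \<open>n\<close> against a prime \<open>q\<close>, then to
  a composite \<open>m\<close>.\<close>

lemma jacobi_reciprocity:
  assumes "m > 0" "odd m" "n > 0" "odd n"
  shows "jacobi m n = (if [m = 3] (mod 4) \<and> [n = 3] (mod 4) then -1 else 1) * jacobi n m"
proof -
  define e :: "int \<Rightarrow> int \<Rightarrow> int"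
    where "e = (\<lambda>m n. if [m = 3] (mod 4) \<and> [n = 3] (mod 4) then -1 else 1)"
  have e_mult: "e (p * m) n = e p n * e m n" if "odd p" "odd m" for p m n
    using that by (auto simp: e_def cong_3_mult_iff)
  have e_commute: "e m n = e n m" for m n by (auto simp: e_def)
  have prime: "Legendre n q = e q n * jacobi q n"
    if "prime q" "odd q" "n > 0" "odd n" for q n
    using that(3,4)
  proof (induction n rule: odd_induct)
    case one
    have "Legendre 1 q = 1" using jacobi_1_left[of q] jacobi_prime_mult[of q 1 1] that prime_gt_0_int
      by simp
    then show ?case by (simp add: e_def cong_def)
  next
    case (factor p n)
    have "Legendre p q = e q p * Legendre q p"
      using Legendre_reciprocity[of p q] factor that by (simp add: e_def conj_commute)
    moreover have "e q (p * n) = e q p * e q n"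
      using e_mult[of p n q] factor by (simp add: e_commute[of q])
    ultimately show ?case
      using factor that by (simp add: jacobi_prime_mult Legendre_mult)
  qed
  have "jacobi m n = e m n * jacobi n m"
    using assms(1,2)
  proof (induction m rule: odd_induct)
    case one
    then show ?case using assms by (simp add: jacobi_1_left e_def cong_def)
  next
    case (factor p m)
    have e2: "e p n * (e p n * x) = x" for x by (simp add: e_def)
    have "Legendre n p = e p n * jacobi p n" using factor assms prime by blast
    then have *: "jacobi p n = e p n * Legendre n p" by (simp add: e2)
    have "jacobi (p * m) n = jacobi p n * jacobi m n"
      using assms by (intro jacobi_mult_left)
    also have "\<dots> = (e p n * Legendre n p) * (e m n * jacobi n m)"
      by (simp only: * factor.IH)
    also have "\<dots> = (e p n * e m n) * (Legendre n p * jacobi n m)"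
      by (simp add: ac_simps)
    also have "\<dots> = e (p * m) n * jacobi n (p * m)"
      using factor by (simp add: e_mult jacobi_prime_mult)
    finally show ?case .
  qed
  then show ?thesis by (simp add: e_def)
qed

section \<open>Squares in the recurrence\<close>

text \<open>For \<open>v = \<alpha>\<^sup>2 + \<alpha>\<^sup>-\<^sup>2\<close>, the choice \<open>a = 2\<close>, \<open>b = v\<close> gives \<open>\<alpha>\<^sup>2\<^sup>n + \<alpha>\<^sup>-\<^sup>2\<^sup>n\<close>, while \<open>a = 1\<close>,
  \<open>b = v \<plusminus> 1\<close> gives \<open>(\<alpha>\<^sup>2\<^sup>n\<^sup>+\<^sup>1 \<mp> \<alpha>\<^sup>-\<^sup>2\<^sup>n\<^sup>-\<^sup>1) / (\<alpha> \<mp> \<alpha>\<^sup>-\<^sup>1)\<close>.\<close>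

fun linrec :: "int \<Rightarrow> int \<Rightarrow> int \<Rightarrow> nat \<Rightarrow> int" where
  "linrec v a b 0 = a"
| "linrec v a b (Suc 0) = b"
| "linrec v a b (Suc (Suc n)) = v * linrec v a b (Suc n) - linrec v a b n"

text \<open>The sequence combines the powers \<open>x^n\<close> with \<open>x = \<alpha>^2\<close>
  and \<open>x = \<alpha>^(-2)\<close>, and
  \<open>x^(n+2k) + x^n = (x^k + x^(-k)) * x^(n+k)\<close>.\<close>

lemma linrec_add_double:
  "linrec v a b (n + 2 * k) + linrec v a b n = linrec v 2 v k * linrec v a b (n + k)"
proof (induction k arbitrary: n rule: induct_nat_012)
  case (ge2 k)
  let ?f = "linrec v a b"
  have "?f (n + 2 * Suc (Suc k)) + ?f n
      = v * (?f (n + 1 + 2 * Suc k) + ?f (n + 1)) - (?f (n + 2 + 2 * k) + ?f (n + 2))"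
    by (simp add: numeral_eq_Suc algebra_simps)
  also have "\<dots> = v * (linrec v 2 v (Suc k) * ?f (n + 1 + Suc k)) - linrec v 2 v k * ?f (n + 2 + k)"
    unfolding ge2 ..
  also have "\<dots> = linrec v 2 v (Suc (Suc k)) * ?f (n + Suc (Suc k))"
    by (simp add: algebra_simps)
  finally show ?case .
qed simp_all

text \<open>Each shift by \<open>2 * k\<close> changes the sign modulo
  \<open>linrec v 2 v k\<close>, and the number of shifts is odd.\<close>

lemma linrec_cong_uminus:
  "[linrec v a b (n + 2 * k * (2 * t + 1)) = - linrec v a b n] (mod linrec v 2 v k)"
proof -
  let ?f = "linrec v a b" and ?V = "linrec v 2 v k"
  have step: "[?f (m + 2 * k) = - ?f m] (mod ?V)" for m
    using linrec_add_double[of v a b m k] by (simp add: cong_iff_dvd_diff)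
  show ?thesis
  proof (induction t)
    case 0
    then show ?case using step[of n] by simp
  next
    case (Suc t)
    let ?N = "n + 2 * k * (2 * t + 1)"
    have "[?f (?N + 2 * k + 2 * k) = - ?f (?N + 2 * k)] (mod ?V)" by (rule step)
    also have "[- ?f (?N + 2 * k) = - (- ?f ?N)] (mod ?V)"
      using step[of ?N] by (simp only: cong_minus_minus_iff)
    also have "[- (- ?f ?N) = - ?f n] (mod ?V)" using Suc by simp
    finally show ?case by (simp add: algebra_simps)
  qed
qed

lemma linrec_pow2_Suc:
  "linrec v 2 v (2 ^ Suc r) = (linrec v 2 v (2 ^ r))^2 - 2"
  using linrec_add_double[of v 2 v 0 "2 ^ r"] by (simp add: power2_eq_square)

lemma linrec_pow2_ge_odd:
  assumes "v \<ge> 3" and "odd v"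
  shows "linrec v 2 v (2 ^ r) \<ge> 3 \<and> odd (linrec v 2 v (2 ^ r))"
proof (induction r)
  case (Suc r)
  then have "3 * 3 \<le> linrec v 2 v (2 ^ r) * linrec v 2 v (2 ^ r)" by (intro mult_mono) auto
  with Suc show ?case unfolding linrec_pow2_Suc by (simp add: power2_eq_square)
qed (use assms in simp)

lemma cong_1_mod_4_if_square_cong_minus_1:
  fixes n z :: int
  assumes "n > 0" "odd n" "[z^2 = -1] (mod n)"
  shows "[n = 1] (mod 4)"
  using jacobi_square_neq[OF assms(1,2), of z] jacobi_cong[OF assms(3)] jacobi_minus_1[OF assms(1,2)]
  by (simp split: if_splits)

section \<open>Jacobi symbols modulo the terms with index a power of two\<close>

context
  fixes v :: int
  assumes v: "v \<ge> 3" "odd v"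
begin

text \<open>From index 2 on, these terms are an odd square minus 2. The term \<open>v\<close> at
  index 1 may be 1 modulo 4, hence \<open>Suc r\<close>.\<close>

lemma linrec_pow2_cong_3: "[linrec v 2 v (2 ^ Suc r) = 3] (mod 4)"
proof -
  obtain x where "linrec v 2 v (2 ^ r) = 2 * x + 1"
    using linrec_pow2_ge_odd[OF v] by (blast elim: oddE)
  then have "linrec v 2 v (2 ^ Suc r) - 3 = 4 * (x^2 + x - 1)"
    unfolding linrec_pow2_Suc by (simp add: power2_eq_square algebra_simps)
  then show ?thesis unfolding cong_iff_dvd_diff by (rule dvdI)
qed

lemma jacobi_minus_1_pow2: "jacobi (-1) (linrec v 2 v (2 ^ Suc r)) = -1"
  using linrec_pow2_ge_odd[OF v, of "Suc r"] linrec_pow2_cong_3[of r]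
  by (simp add: jacobi_minus_1 cong_1_iff_not_cong_3 del: power_Suc)

text \<open>Modulo this term, 2 is the square of the preceding one, which is odd and therefore
  coprime to it.\<close>

lemma jacobi_2_pow2: "jacobi 2 (linrec v 2 v (2 ^ Suc r)) = 1"
proof -
  let ?x = "linrec v 2 v (2 ^ r)" and ?y = "linrec v 2 v (2 ^ Suc r)"
  have y: "?y = ?x^2 - 2" by (rule linrec_pow2_Suc)
  have "coprime ?x 2" using linrec_pow2_ge_odd[OF v, of r] by simp
  have "coprime ?x ?y"
  proof (rule coprimeI)
    fix d
    assume d: "d dvd ?x" "d dvd ?y"
    then have "d dvd ?x^2 - ?y" by (intro dvd_diff) (simp_all add: power2_eq_square)
    then have "d dvd 2" unfolding y by simp
    with \<open>coprime ?x 2\<close> d(1) show "is_unit d" by (rule coprime_common_divisor)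
  qed
  then have "jacobi (?x^2) ?y = 1"
    using linrec_pow2_ge_odd[OF v, of "Suc r"] by (intro jacobi_square) (auto simp del: power_Suc)
  moreover have "[?x^2 = 2] (mod ?y)" unfolding y by (simp add: cong_iff_dvd_diff)
  ultimately show ?thesis using jacobi_cong by metis
qed

text \<open>Powers of 2 contribute 1, which leaves the odd part \<open>w\<close> of
  \<open>v + 1\<close>. As \<open>y\<close> is -1 modulo \<open>w\<close>, the reciprocity sign and
  \<open>jacobi (-1) w\<close> are equal and cancel.\<close>

lemma jacobi_Suc_pow2: "jacobi (v + 1) (linrec v 2 v (2 ^ Suc r)) = 1"
proof -
  define y where "y = linrec v 2 v (2 ^ Suc r)"
  have y: "y > 0" "odd y" "[y = 3] (mod 4)"
    using linrec_pow2_ge_odd[OF v, of "Suc r"] linrec_pow2_cong_3[of r]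
    by (auto simp: y_def simp del: power_Suc)
  have y1: "[y = -1] (mod v + 1)"
    unfolding y_def
  proof (induction r)
    case 0
    have "linrec v 2 v (2 ^ Suc 0) - (- 1) = (v + 1) * (v - 1)"
      unfolding linrec_pow2_Suc by (simp add: power2_eq_square algebra_simps)
    then show ?case unfolding cong_iff_dvd_diff by (rule dvdI)
  next
    case (Suc r)
    have "[(linrec v 2 v (2 ^ Suc r))^2 - 2 = (-1)^2 - 2] (mod v + 1)"
      by (intro cong_diff cong_pow Suc) simp
    then show ?case unfolding linrec_pow2_Suc[of v "Suc r"] by simp
  qed
  obtain w where w: "v + 1 = 2 ^ multiplicity 2 (v + 1) * w" "\<not> 2 dvd w"
    using multiplicity_decompose'[of "v + 1" 2] v by auto
  have "w > 0" using w(1) v zero_less_mult_pos[of "2 ^ multiplicity 2 (v + 1)" w] by simp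
  have "jacobi 2 y = 1" unfolding y_def by (rule jacobi_2_pow2)
  then have "jacobi (2 ^ k) y = 1" for k
    by (induction k) (use y in \<open>simp_all add: jacobi_mult_left jacobi_1_left\<close>)
  then have "jacobi (v + 1) y = jacobi w y"
    using y w(1) by (metis jacobi_mult_left mult_1)
  also have "\<dots> = (if [w = 3] (mod 4) then -1 else 1) * jacobi y w"
    using y \<open>w > 0\<close> w(2) jacobi_reciprocity[of w y] by simp
  also have "jacobi y w = jacobi (-1) w"
    using y1 w(1) by (intro jacobi_cong) (metis cong_dvd_modulus dvd_triv_right)
  also have "\<dots> = (if [w = 3] (mod 4) then -1 else 1)"
    using \<open>w > 0\<close> w(2) by (simp add: jacobi_minus_1 cong_1_iff_not_cong_3)
  finally show ?thesis by (simp add: y_def split: if_splits)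
qed

lemma jacobi_quadratic_pow2:
  assumes "[v = 1] (mod 4)"
  shows "jacobi (v^2 + v - 1) (linrec v 2 v (2 ^ Suc r)) = 1"
proof -
  define y where "y = linrec v 2 v (2 ^ Suc r)"
  define q where "q = v^2 + v - 1"
  have y: "y > 0" "odd y" "[y = 3] (mod 4)"
    using linrec_pow2_ge_odd[OF v, of "Suc r"] linrec_pow2_cong_3[of r]
    by (auto simp: y_def simp del: power_Suc)
  have "[q = 1^2 + 1 - 1] (mod 4)"
    unfolding q_def by (intro cong_diff cong_add cong_pow assms) simp_all
  then have q1: "[q = 1] (mod 4)" by simp
  have "0 < q"
    using v(1) zero_le_power2[of v] unfolding q_def by linarith
  moreover have "odd q"
    using v(2) by (simp add: q_def)
  ultimately have q: "q > 0" "odd q" .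
  have q3: "\<not> [q = 3] (mod 4)" using q1 cong_1_iff_not_cong_3[OF q(2)] by simp
  \<comment> \<open>Modulo \<open>q\<close>, \<open>\<alpha>^2\<close> behaves like a primitive
    fifth root of unity, so the map \<open>x^2 - 2\<close> swaps \<open>v\<close> and
    \<open>- (v + 1)\<close>.\<close>
  have "[y = - (v + 1)] (mod q) \<or> [y = v] (mod q)"
    unfolding y_def
  proof (induction r)
    case 0
    have "linrec v 2 v (2 ^ Suc 0) - (- (v + 1)) = q"
      unfolding linrec_pow2_Suc by (simp add: q_def)
    then show ?case by (simp add: cong_iff_dvd_diff)
  next
    case (Suc r)
    let ?x = "linrec v 2 v (2 ^ Suc r)"
    consider "[?x = - (v + 1)] (mod q)" | "[?x = v] (mod q)" using Suc by blast
    then show ?case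
    proof cases
      case 1
      then have "[?x^2 - 2 = (- (v + 1))^2 - 2] (mod q)" by (intro cong_diff cong_pow) simp_all
      also have "(- (v + 1))^2 - 2 = v + q" by (simp add: q_def power2_eq_square algebra_simps)
      also have "[v + q = v] (mod q)" by (simp add: cong_iff_dvd_diff)
      finally show ?thesis unfolding linrec_pow2_Suc[of v "Suc r"] by blast
    next
      case 2
      then have "[?x^2 - 2 = v^2 - 2] (mod q)" by (intro cong_diff cong_pow) simp_all
      also have "v^2 - 2 = - (v + 1) + q" by (simp add: q_def power2_eq_square algebra_simps)
      also have "[- (v + 1) + q = - (v + 1)] (mod q)" by (simp add: cong_iff_dvd_diff)
      finally show ?thesis unfolding linrec_pow2_Suc[of v "Suc r"] by blast
    qed
  qed
  moreover have jv: "jacobi v q = 1"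
  proof -
    have "jacobi v q = jacobi q v" using jacobi_reciprocity[of v q] v q q3 by simp
    also have "\<dots> = jacobi (-1) v"
      by (intro jacobi_cong) (simp add: cong_iff_dvd_diff q_def power2_eq_square)
    also have "\<dots> = 1" using v assms by (simp add: jacobi_minus_1)
    finally show ?thesis .
  qed
  moreover have "jacobi (- (v + 1)) q = 1"
  proof -
    \<comment> \<open>\<open>v\<close> and \<open>v + 1\<close> are inverse modulo \<open>q\<close>,
      so their symbols agree.\<close>
    have "[v * (v + 1) = 1] (mod q)"
      by (simp add: cong_iff_dvd_diff q_def power2_eq_square algebra_simps)
    then have "jacobi v q * jacobi (v + 1) q = 1"
      using jacobi_cong jacobi_1_left jacobi_mult_left q by metis
    moreover have "jacobi (- (v + 1)) q = jacobi (-1) q * jacobi (v + 1) q"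
      using jacobi_mult_left[of q "-1" "v + 1"] q by simp
    ultimately show ?thesis using jv q q1 by (simp add: jacobi_minus_1)
  qed
  ultimately have "jacobi y q = 1" using jacobi_cong by metis
  then have "jacobi q y = 1" using jacobi_reciprocity[of q y] y q q3 by simp
  then show ?thesis by (simp add: y_def q_def)
qed

lemma linrec_neq_square:
  assumes "jacobi (linrec v a b c) (linrec v 2 v (2 ^ Suc r)) = 1"
  shows "linrec v a b (c + 2 * 2 ^ Suc r * (2 * t + 1)) \<noteq> z^2"
proof
  let ?y = "linrec v 2 v (2 ^ Suc r)"
  have y: "?y > 0" "odd ?y" using linrec_pow2_ge_odd[OF v, of "Suc r"] by (auto simp del: power_Suc)
  assume "linrec v a b (c + 2 * 2 ^ Suc r * (2 * t + 1)) = z^2"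
  then have "jacobi (z^2) ?y = jacobi (- linrec v a b c) ?y"
    by (metis linrec_cong_uminus jacobi_cong)
  also have "\<dots> = jacobi (-1) ?y * jacobi (linrec v a b c) ?y"
    using jacobi_mult_left[OF y, of "-1" "linrec v a b c"] by simp
  also have "\<dots> = -1" unfolding jacobi_minus_1_pow2 assms by simp
  finally show False using jacobi_square_neq[OF y] by blast
qed

lemma linrec_odd_square_imp_0:
  assumes "odd z" and sq: "linrec v 1 (v + 1) j = z^2"
  shows "j = 0"
proof (rule ccontr)
  assume "j \<noteq> 0"
  let ?W = "linrec v 1 (v + 1)"
  have not_res: "j \<le> c" if c: "[j = c] (mod 4)" "\<And>r. jacobi (?W c) (linrec v 2 v (2 ^ Suc r)) = 1" for c
  proof (rule ccontr)
    assume "\<not> j \<le> c"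
    then have "4 dvd j - c" using c(1) by (simp add: cong_altdef_nat)
    then obtain m where "j - c = 4 * m" by blast
    then have m: "j = c + 4 * m" "m \<noteq> 0" using \<open>\<not> j \<le> c\<close> by auto
    \<comment> \<open>The power of 2 in \<open>m\<close> selects the modulus: \<open>4 * m\<close>
      is an odd multiple of twice the index \<open>2 ^ Suc (multiplicity 2 m)\<close>.\<close>
    obtain w where "m = 2 ^ multiplicity 2 m * w" "\<not> 2 dvd w"
      using multiplicity_decompose'[of m 2] m(2) by auto
    moreover from this obtain t where "w = 2 * t + 1" by (elim oddE)
    ultimately have "j = c + 2 * 2 ^ Suc (multiplicity 2 m) * (2 * t + 1)"
      using m(1) by (simp add: mult.assoc)
    then show False using linrec_neq_square[OF c(2)] sq by metis
  qed
  have mod_v: "[z^2 = -1] (mod v)" if "[j = 2] (mod 4) \<or> [j = 3] (mod 4)"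
  proof -
    \<comment> \<open>Here the modulus has index 1, that is \<open>v\<close>: \<open>j\<close> is
      \<open>c\<close> plus an odd multiple of 2, and \<open>?W 0\<close> and \<open>?W 1\<close>
      are both 1 modulo \<open>v\<close>.\<close>
    define c where "c = j mod 2"
    have "j div 2 mod 2 = 1" using that unfolding cong_def by presburger
    then have "odd (j div 2)" by presburger
    then obtain t where "j div 2 = 2 * t + 1" by (elim oddE)
    then have "j = c + 2 * 1 * (2 * t + 1)" by (simp add: c_def) presburger
    then have "[z^2 = - ?W c] (mod v)"
      using linrec_cong_uminus[of v 1 "v + 1" c 1 t] sq by simp
    moreover have "c = 0 \<or> c = 1" by (auto simp: c_def)
    then have "[- ?W c = -1] (mod v)" by (auto simp: cong_iff_dvd_diff)
    ultimately show ?thesis by (rule cong_trans)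
  qed
  consider "[j = 0] (mod 4)" | "[j = 1] (mod 4)" | "[j = 2] (mod 4)" | "[j = 3] (mod 4)"
    unfolding cong_def by fastforce
  then show False
  proof cases
    case 1
    moreover have "jacobi 1 (linrec v 2 v (2 ^ Suc r)) = 1" for r
      using linrec_pow2_ge_odd[OF v, of "Suc r"] by (intro jacobi_1_left) linarith+
    ultimately show False using not_res[of 0] \<open>j \<noteq> 0\<close> by simp
  next
    case 2
    then have "j = 1" using not_res[of 1] \<open>j \<noteq> 0\<close> jacobi_Suc_pow2 by (simp del: power_Suc)
    then have "v + 1 = z^2" using sq by simp
    then show False using \<open>odd z\<close> v by (metis even_plus_one_iff even_power)
  next
    case 3
    have "[v = 1] (mod 4)"
      using mod_v 3 v by (intro cong_1_mod_4_if_square_cong_minus_1) auto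
    moreover have W2: "?W 2 = v^2 + v - 1" by (simp add: numeral_eq_Suc algebra_simps)
    ultimately have "j \<le> 2" using 3 not_res[of 2] jacobi_quadratic_pow2 by (simp del: power_Suc)
    moreover have "j mod 4 = 2" using 3 by (simp add: cong_def)
    ultimately have "j = 2" by presburger
    then have z: "\<bar>z\<bar>^2 = v^2 + v - 1" using sq W2 by simp
    then have less: "v^2 < \<bar>z\<bar>^2" "\<bar>z\<bar>^2 < (v + 1)^2"
      using v unfolding z power2_sum by simp_all
    have "v < \<bar>z\<bar>" "\<bar>z\<bar> < v + 1"
      by (rule power2_less_imp_less[OF less(1)] power2_less_imp_less[OF less(2)]; use v in simp)+
    then show False by simp
  next
    case 4
    have "[v = 1] (mod 4)"
      using mod_v 4 v by (intro cong_1_mod_4_if_square_cong_minus_1) auto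
    \<comment> \<open>With \<open>v\<close> replaced by -2 the characteristic polynomial is
      \<open>(X + 1)^2\<close>, and the initial values become 1 and -1.\<close>
    have "[?W n = (-1) ^ n] (mod v + 2)" for n
    proof (induction n rule: induct_nat_012)
      case (ge2 n)
      have "[?W (Suc (Suc n)) = - 2 * (-1) ^ Suc n - (-1) ^ n] (mod v + 2)"
        unfolding linrec.simps by (intro cong_diff cong_mult ge2) (simp add: cong_iff_dvd_diff)
      then show ?case by simp
    qed (simp_all add: cong_iff_dvd_diff add.commute)
    from this[of j] have "[z^2 = (-1) ^ j] (mod v + 2)" unfolding sq .
    moreover have "odd j" using 4 unfolding cong_def by presburger
    ultimately have "[z^2 = -1] (mod v + 2)" by simp
    then have "[v + 2 = 1] (mod 4)"
      using v by (intro cong_1_mod_4_if_square_cong_minus_1) auto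
    then have "[(v + 2) - v = 1 - 1] (mod 4)" using \<open>[v = 1] (mod 4)\<close> by (rule cong_diff)
    then show False by (simp add: cong_def)
  qed
qed

end

section \<open>Solutions of the Pell-type equation\<close>

text \<open>This is multiplication by \<open>\<alpha>^2\<close> in coordinates, for solutions
  \<open>(a * Z, b * W)\<close> with \<open>A * a^2 = v + 2\<close> and
  \<open>B * b^2 = v - 2\<close>.\<close>

lemma linrec_pell_step:
  "2 * linrec v 1 (v + 1) (Suc n) = v * linrec v 1 (v + 1) n + (v + 2) * linrec v 1 (v - 1) n"
  "2 * linrec v 1 (v - 1) (Suc n) = v * linrec v 1 (v - 1) n + (v - 2) * linrec v 1 (v + 1) n"
proof (induction n rule: induct_nat_012)
  case 0 {case 1 show ?case by simp next case 2 show ?case by simp}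
next
  case 1 {case 1 show ?case by (simp add: algebra_simps) next case 2 show ?case by (simp add: algebra_simps)}
next
  case (ge2 n)
  let ?W = "linrec v 1 (v + 1)" and ?Z = "linrec v 1 (v - 1)"
  {
    case 1
    have "2 * ?W (Suc (Suc (Suc n))) = v * (2 * ?W (Suc (Suc n))) - 2 * ?W (Suc n)"
      by (simp add: algebra_simps)
    also have "\<dots> = v * (v * ?W (Suc n) + (v + 2) * ?Z (Suc n)) - (v * ?W n + (v + 2) * ?Z n)"
      by (simp only: ge2)
    also have "\<dots> = v * ?W (Suc (Suc n)) + (v + 2) * ?Z (Suc (Suc n))"
      by (simp add: algebra_simps)
    finally show ?case .
  next
    case 2
    have "2 * ?Z (Suc (Suc (Suc n))) = v * (2 * ?Z (Suc (Suc n))) - 2 * ?Z (Suc n)"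
      by (simp add: algebra_simps)
    also have "\<dots> = v * (v * ?Z (Suc n) + (v - 2) * ?W (Suc n)) - (v * ?Z n + (v - 2) * ?W n)"
      by (simp only: ge2)
    also have "\<dots> = v * ?Z (Suc (Suc n)) + (v - 2) * ?W (Suc (Suc n))"
      by (simp add: algebra_simps)
    finally show ?case .
  }
qed

text \<open>Descent on \<open>y\<close>: multiplication by \<open>\<alpha>^(-2)\<close> gives a
  solution with \<open>0 < y' < y\<close>, and multiplying back raises the index by one.\<close>

lemma pell_solutions:
  fixes A B a b x y :: int
  assumes A: "A > 1" "odd A" and B: "B > 0" "odd B"
    and ab: "a > 0" "b > 0" "A * a^2 - B * b^2 = 4"
    and min: "\<And>x y. x > 0 \<Longrightarrow> y > 0 \<Longrightarrow> A * x^2 - B * y^2 = 4 \<Longrightarrow> b \<le> y"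
    and v: "v = A * a^2 - 2"
    and xy: "x > 0" "y > 0" "A * x^2 - B * y^2 = 4"
  shows "\<exists>n. x = a * linrec v 1 (v - 1) n \<and> y = b * linrec v 1 (v + 1) n"
  using xy
proof (induction "nat y" arbitrary: x y rule: less_induct)
  case (less y x)
  note xy = less.prems
  have v': "v = B * b^2 + 2" using v ab(3) by simp
  have Aa: "A * a^2 = v + 2" and Bb: "B * b^2 = v - 2" using v v' by simp_all
  have vv: "(A * a^2) * (B * b^2) = v^2 - 4"
    unfolding Aa Bb by (simp add: power2_eq_square algebra_simps)
  have "B * b^2 > 0" using B ab by simp
  then have v2: "v > 2" using v' by simp
  consider "y = b" | "y > b" using min[OF xy] by linarith
  then show ?case
  proof cases
    case 1
    then have "A * x^2 = A * a^2" using xy(3) ab(3) unfolding 1 by linarith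
    then have "x^2 = a^2" using A by simp
    then have "x = a" using xy(1) ab(1) by (simp add: power2_eq_iff_nonneg)
    with 1 show ?thesis by (intro exI[of _ 0]) simp
  next
    case 2
    \<comment> \<open>Matching parities make \<open>x'\<close> and \<open>y'\<close> below
      integers.\<close>
    have par: "even a = even b" "even x = even y"
    proof -
      have "even (A * a^2 - B * b^2)" "even (A * x^2 - B * y^2)" unfolding ab xy by simp_all
      then show "even a = even b" "even x = even y" using A B by simp_all
    qed
    have "even v \<longleftrightarrow> even a" using v A by simp
    then have "even (v * y - a * b * A * x)" "even (v * x - a * b * B * y)"
      using par A B by auto
    \<comment> \<open>\<open>(x', y')\<close> belongs to the product of \<open>(x \<surd>A + y \<surd>B) / 2\<close> with \<open>\<alpha>\<^sup>-\<^sup>2\<close>\<close>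
    then obtain y' x'
      where y': "v * y - a * b * A * x = 2 * y'" and x': "v * x - a * b * B * y = 2 * x'"
      by (meson evenE)
    have "4 * (A * x'^2 - B * y'^2) = A * (v * x - a * b * B * y)^2 - B * (v * y - a * b * A * x)^2"
      unfolding y' x' by (simp add: power2_eq_square algebra_simps)
    also have "\<dots> = (v^2 - (A * a^2) * (B * b^2)) * (A * x^2 - B * y^2)"
      by (simp add: power2_eq_square algebra_simps)
    also have "v^2 - (A * a^2) * (B * b^2) = 4" unfolding vv by simp
    finally have sol': "A * x'^2 - B * y'^2 = 4" using xy by simp
    have "x' > 0"
    proof -
      have "(a * b * B * y)^2 = (A * a^2) * (B * b^2) * x^2 - a^2 * b^2 * B * (A * x^2 - B * y^2)"
        by (simp add: power2_eq_square algebra_simps)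
      also have "\<dots> = v^2 * x^2 - 4 * x^2 - 4 * a^2 * b^2 * B"
        unfolding vv xy by (simp add: algebra_simps)
      also have "\<dots> < (v * x)^2"
      proof -
        have "0 < x^2" "0 < a^2 * b^2 * B" using xy(1) ab(1,2) B by simp_all
        then show ?thesis unfolding power_mult_distrib by linarith
      qed
      finally have "a * b * B * y < v * x"
        by (rule power2_less_imp_less) (use v2 xy(1) in simp)
      then show ?thesis using x' by simp
    qed
    have "y' < y"
    proof -
      have "(B * b * y)^2 = (B * b^2) * (B * y^2)" by (simp add: power2_eq_square algebra_simps)
      also have "\<dots> < (A * a^2) * (A * x^2)"
      proof (rule mult_strict_mono)
        show "B * b^2 < A * a^2" "B * y^2 < A * x^2" using ab(3) xy(3) by linarith+
        show "0 < A * a^2" "0 \<le> B * y^2" using A ab(1) B by simp_all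
      qed
      also have "\<dots> = (A * a * x)^2" by (simp add: power2_eq_square algebra_simps)
      finally have "B * b * y < A * a * x"
        by (rule power2_less_imp_less) (use A(1) ab(1) xy(1) in simp)
      then have "b * (B * b * y) < b * (A * a * x)" using ab(2) by simp
      then have "(v - 2) * y < a * b * A * x" unfolding v' by (simp add: power2_eq_square algebra_simps)
      then show ?thesis using y' by (simp add: algebra_simps)
    qed
    \<comment> \<open>With this bound a negative \<open>y'\<close> would give the solution
      \<open>(x', - y')\<close> with second component below the minimum \<open>b\<close>.\<close>
    have "- b < y'"
    proof -
      have "(a * b * A * x)^2 = (A * a^2) * (B * b^2) * y^2 + A * a^2 * b^2 * (A * x^2 - B * y^2)"
        by (simp add: power2_eq_square algebra_simps)
      also have "\<dots> = (v^2 - 4) * y^2 + 4 * b^2 * (v + 2)"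
        unfolding vv xy using v by (simp add: algebra_simps)
      also have "\<dots> = (v * y + 2 * b)^2 - 4 * ((y^2 - b^2) + v * b * (y - b))"
        by (simp add: power2_eq_square algebra_simps)
      also have "\<dots> < (v * y + 2 * b)^2"
      proof -
        have "b^2 < y^2" using 2 ab(2) by (intro power_strict_mono) auto
        moreover have "0 < v * b * (y - b)" using 2 ab(2) v2 by simp
        ultimately show ?thesis by simp
      qed
      finally have "a * b * A * x < v * y + 2 * b"
        by (rule power2_less_imp_less) (use v2 xy(2) ab(2) in simp)
      then show ?thesis using y' by simp
    qed
    have "y' \<noteq> 0"
    proof
      assume "y' = 0"
      then have "A * x'^2 = 4" using sol' by simp
      then have "A dvd 2^2" by (intro dvdI[of _ _ "x'^2"]) simp
      have "coprime A (2^2)"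
        unfolding coprime_power_right_iff using A(2) by simp
      then have "is_unit A"
        using dvd_refl \<open>A dvd 2^2\<close> by (rule coprime_common_divisor)
      then show False using A by simp
    qed
    moreover have "\<not> y' < 0"
    proof
      assume "y' < 0"
      then have "b \<le> - y'" using min[of x' "- y'"] \<open>x' > 0\<close> sol' by simp
      then show False using \<open>- b < y'\<close> by simp
    qed
    ultimately have "y' > 0" by simp
    then obtain n where n: "x' = a * linrec v 1 (v - 1) n" "y' = b * linrec v 1 (v + 1) n"
      using less.hyps[OF _ \<open>x' > 0\<close> \<open>y' > 0\<close> sol'] \<open>y' < y\<close> \<open>y' > 0\<close> by force
    let ?W = "linrec v 1 (v + 1)" and ?Z = "linrec v 1 (v - 1)"
    \<comment> \<open>Recover \<open>(x, y)\<close> from \<open>(x', y')\<close> by multiplying with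
      \<open>\<alpha>^2\<close>.\<close>
    have "4 * y = (v^2 - (A * a^2) * (B * b^2)) * y" unfolding vv by simp
    also have "\<dots> = v * (v * y - a * b * A * x) + a * b * A * (v * x - a * b * B * y)"
      by (simp add: power2_eq_square algebra_simps)
    also have "\<dots> = 2 * b * (v * ?W n + (A * a^2) * ?Z n)"
      unfolding x' y' n by (simp add: power2_eq_square algebra_simps)
    also have "\<dots> = 4 * (b * ?W (Suc n))"
      unfolding Aa linrec_pell_step(1)[symmetric] by simp
    finally have "y = b * ?W (Suc n)" by simp
    have "4 * x = (v^2 - (A * a^2) * (B * b^2)) * x" unfolding vv by simp
    also have "\<dots> = v * (v * x - a * b * B * y) + a * b * B * (v * y - a * b * A * x)"
      by (simp add: power2_eq_square algebra_simps)
    also have "\<dots> = 2 * a * (v * ?Z n + (B * b^2) * ?W n)"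
      unfolding x' y' n by (simp add: power2_eq_square algebra_simps)
    also have "\<dots> = 4 * (a * ?Z (Suc n))"
      unfolding Bb linrec_pell_step(2)[symmetric] by simp
    finally have "x = a * ?Z (Suc n)" by simp
    with \<open>y = b * ?W (Suc n)\<close> show ?thesis by blast
  qed
qed

section \<open>Reduction of two solutions to one Pell-type equation\<close>

theorem theorem3:
  fixes A B :: int
  assumes "A > 0" and "B > 0"
    and "squarefree A" and "A > 1"
    and "odd (A * B)"
    and "\<not> is_square (A * B)"
  shows "\<exists>\<^sub>\<le>\<^sub>1 (x, y). (x :: int) > 0 \<and> (y :: int) > 0 \<and> coprime x y \<and> A * x\<^sup>2 - B * y ^ 4 = 4"
proof -
  have oddAB: "odd A" "odd B" using assms(5) by simp_all
  have odd_y: "odd y" if "coprime x y" "A * x\<^sup>2 - B * y ^ 4 = 4" for x y :: int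
  proof
    assume "even y"
    have "even (A * x\<^sup>2 - B * y ^ 4)" unfolding that(2) by simp
    with \<open>even y\<close> have "even x" using oddAB by simp
    with \<open>even y\<close> that(1) show False by (meson coprime_common_divisor odd_one)
  qed
  have "x1 = x2 \<and> y1 = y2"
    if xy1: "x1 > 0" "y1 > 0" "coprime x1 y1" "A * x1\<^sup>2 - B * y1 ^ 4 = 4"
      and xy2: "x2 > 0" "y2 > 0" "coprime x2 y2" "A * x2\<^sup>2 - B * y2 ^ 4 = 4" for x1 y1 x2 y2 :: int
  proof -
    define g where "g = gcd y1 y2"
    obtain z1 z2 where z: "y1 = g * z1" "y2 = g * z2" "coprime z1 z2"
      using gcd_coprime_exists[of y1 y2] xy1(2) unfolding g_def by (auto simp: mult.commute)
    have "g > 0" using xy1(2) by (simp add: g_def)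
    then have zpos: "z1 > 0" "z2 > 0" using z xy1(2) xy2(2) by (simp_all add: zero_less_mult_iff)
    have "odd y1" "odd y2" using odd_y xy1 xy2 by blast+
    then have zodd: "odd g" "odd z1" "odd z2" using z by simp_all
    \<comment> \<open>Absorbing \<open>g ^ 4\<close> puts both solutions on the same equation, now
      with coprime second components.\<close>
    define C where "C = B * g ^ 4"
    have C: "C > 0" "odd C" using \<open>g > 0\<close> zodd assms oddAB by (simp_all add: C_def)
    have sol: "A * x1\<^sup>2 - C * (z1\<^sup>2)\<^sup>2 = 4" "A * x2\<^sup>2 - C * (z2\<^sup>2)\<^sup>2 = 4"
      using xy1(4) xy2(4) unfolding z C_def by (simp_all add: power_mult_distrib algebra_simps)
    define P where "P = (\<lambda>b. b > 0 \<and> (\<exists>a > 0. A * a\<^sup>2 - C * b\<^sup>2 = 4))"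
    \<comment> \<open>The minimum is taken over the naturals, which are well-ordered.\<close>
    define b where "b = int (LEAST n. P (int n))"
    have "P (int (nat (z1\<^sup>2)))" unfolding P_def using xy1(1) zpos(1) sol(1) by auto
    then have "P b" unfolding b_def by (rule LeastI)
    then obtain a where ab: "b > 0" "a > 0" "A * a\<^sup>2 - C * b\<^sup>2 = 4" unfolding P_def by blast
    have min: "b \<le> y" if "x > 0" "y > 0" "A * x\<^sup>2 - C * y\<^sup>2 = 4" for x y
    proof -
      have "P (int (nat y))" unfolding P_def using that by auto
      then have "(LEAST n. P (int n)) \<le> nat y" by (rule Least_le)
      then show ?thesis unfolding b_def using that by linarith
    qed
    define v where "v = A * a\<^sup>2 - 2"
    have all: "\<exists>n. x = a * linrec v 1 (v - 1) n \<and> y = b * linrec v 1 (v + 1) n"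
      if "x > 0" "y > 0" "A * x\<^sup>2 - C * y\<^sup>2 = 4" for x y
      by (rule pell_solutions[OF \<open>A > 1\<close> \<open>odd A\<close> C ab(2,1,3) _ v_def that]) (rule min)
    obtain m where m: "x1 = a * linrec v 1 (v - 1) m" "z1\<^sup>2 = b * linrec v 1 (v + 1) m"
      using all[OF xy1(1) _ sol(1)] zpos by fastforce
    obtain n where n: "x2 = a * linrec v 1 (v - 1) n" "z2\<^sup>2 = b * linrec v 1 (v + 1) n"
      using all[OF xy2(1) _ sol(2)] zpos by fastforce
    have "b dvd z1\<^sup>2" "b dvd z2\<^sup>2" unfolding m n by simp_all
    moreover have "coprime (z1\<^sup>2) (z2\<^sup>2)" using z(3) by simp
    ultimately have "is_unit b" by (meson coprime_common_divisor)
    then have "b = 1" using ab(1) by simp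
    have "v = C + 2" using ab(3) \<open>b = 1\<close> by (simp add: v_def)
    then have v: "v \<ge> 3" "odd v" using C by simp_all
    have "m = 0" using linrec_odd_square_imp_0[OF v \<open>odd z1\<close>, of m] m(2) \<open>b = 1\<close> by simp
    moreover have "n = 0" using linrec_odd_square_imp_0[OF v \<open>odd z2\<close>, of n] n(2) \<open>b = 1\<close> by simp
    ultimately have "x1 = x2" "z1\<^sup>2 = z2\<^sup>2" using m n by simp_all
    then show ?thesis using z zpos by (simp add: power2_eq_iff_nonneg)
  qed
  then show ?thesis unfolding Uniq_def by auto
qed

end
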